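(* Let $G$ be a group of odd order, and consider the Explorer-Director game on $G$. If $U\subseteq G$ is attainable as a set of unvisited positions under optimum play, then $U$ is a coset of a proper twisted subgroup of $G$. Moreover, if $C$ is a coset of a twisted subgroup of $G$ and if the token does not start in $C$, then there is a strategy for Director that prevents the token from visiting any of the elements of $C$.
   Context: Twisted subgroup: a subset $P$ of a group $G$ is a twisted subgroup of $G$ if $P$ contains the identity and $aba\in P$ whenever $a,b\in P$. It is proper if $P\neq G$. A coset of a twisted subgroup $P$ is a set $gP=\{gp : p\in P\}$ with $g\in G$. Explorer-Director game on a finite group $G$: a token starts at some given element of $G$ (which counts as visited). The game is played in rounds, with no limit on the number of rounds. In each round, if the token is at $x$, Explorer picks an element $g\in G$, and then Director moves the token to either $xg$ or $xg^{-1}$, as Director chooses. Explorer wants to minimize, and Director to maximize, the number of elements of $G$ never visited by the token. Let $f(G)$ be the number of elements visited assuming optimal play by both players. A strategy for Explorer is optimal if it guarantees that at least $f(G)$ elements are visited, and a strategy for Director is optimal if it guarantees that at most $f(G)$ elements are visited. A set $U\subseteq G$ is attainable as a set of unvisited positions under optimum play if, for some optimal strategies of the two players played against each other, $U$ is exactly the set of elements of $G$ never visited by the token.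
   Formalization: The first claim is stated for nontrivial G only: in the trivial group the empty set is attainable as the set of unvisited positions, but there is no proper twisted subgroup, so the claim fails there. *)

theory Defs
  imports "HOL-Algebra.Coset"
begin

definition twisted_subgroup :: "('a, 'b) monoid_scheme \<Rightarrow> 'a set \<Rightarrow> bool" where
  "twisted_subgroup G P \<longleftrightarrow>
     P \<subseteq> carrier G \<and> \<one>\<^bsub>G\<^esub> \<in> P \<and> (\<forall>a\<in>P. \<forall>b\<in>P. a \<otimes>\<^bsub>G\<^esub> b \<otimes>\<^bsub>G\<^esub> a \<in> P)"

definition twisted_coset :: "('a, 'b) monoid_scheme \<Rightarrow> 'a set \<Rightarrow> 'a set \<Rightarrow> bool" where
  "twisted_coset G P C \<longleftrightarrow> twisted_subgroup G P \<and> (\<exists>g\<in>carrier G. C = g <#\<^bsub>G\<^esub> P)"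

text \<open>
  A history lists the completed rounds, oldest first: the element \<open>g\<close> picked by Explorer, and
  whether Director then multiplied by \<open>g\<close> (\<open>True\<close>) or by its inverse (\<open>False\<close>). Strategies are
  deterministic and may depend on the whole history; Director also sees the current pick.
\<close>

type_synonym 'a history = "('a \<times> bool) list"
type_synonym 'a explorer = "'a history \<Rightarrow> 'a"
type_synonym 'a director = "'a history \<Rightarrow> 'a \<Rightarrow> bool"

definition explorer_strategies :: "('a, 'b) monoid_scheme \<Rightarrow> 'a explorer set" where
  "explorer_strategies G = {\<sigma>. \<forall>h. \<sigma> h \<in> carrier G}"

primrec play :: "'a explorer \<Rightarrow> 'a director \<Rightarrow> nat \<Rightarrow> 'a history" where
  "play \<sigma> \<tau> 0 = []"
| "play \<sigma> \<tau> (Suc n) = (let h = play \<sigma> \<tau> n; g = \<sigma> h in h @ [(g, \<tau> h g)])"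

definition position :: "('a, 'b) monoid_scheme \<Rightarrow> 'a \<Rightarrow> 'a history \<Rightarrow> 'a" where
  "position G s h = foldl (\<lambda>x (g, b). x \<otimes>\<^bsub>G\<^esub> (if b then g else inv\<^bsub>G\<^esub> g)) s h"

definition visited ::
    "('a, 'b) monoid_scheme \<Rightarrow> 'a \<Rightarrow> 'a explorer \<Rightarrow> 'a director \<Rightarrow> 'a set" where
  "visited G s \<sigma> \<tau> = range (\<lambda>n. position G s (play \<sigma> \<tau> n))"

text \<open>
  The number \<open>f(G)\<close>, as the max-min value of the game with the token starting at \<open>s\<close>; by left
  translation it does not depend on \<open>s\<close>. For finite \<open>G\<close> the supremum and the infima are
  attained, and the game is determined, so this is also the min-max value.
\<close>

definition game_value :: "('a, 'b) monoid_scheme \<Rightarrow> 'a \<Rightarrow> nat" where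
  "game_value G s = (SUP \<sigma>\<in>explorer_strategies G. INF \<tau>. card (visited G s \<sigma> \<tau>))"

definition explorer_optimal :: "('a, 'b) monoid_scheme \<Rightarrow> 'a \<Rightarrow> 'a explorer \<Rightarrow> bool" where
  "explorer_optimal G s \<sigma> \<longleftrightarrow>
     \<sigma> \<in> explorer_strategies G \<and> (\<forall>\<tau>. game_value G s \<le> card (visited G s \<sigma> \<tau>))"

definition director_optimal :: "('a, 'b) monoid_scheme \<Rightarrow> 'a \<Rightarrow> 'a director \<Rightarrow> bool" where
  "director_optimal G s \<tau> \<longleftrightarrow>
     (\<forall>\<sigma>\<in>explorer_strategies G. card (visited G s \<sigma> \<tau>) \<le> game_value G s)"

definition attainable_unvisited :: "('a, 'b) monoid_scheme \<Rightarrow> 'a \<Rightarrow> 'a set \<Rightarrow> bool" where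
  "attainable_unvisited G s U \<longleftrightarrow>
     (\<exists>\<sigma> \<tau>. explorer_optimal G s \<sigma> \<and> director_optimal G s \<tau> \<and> U = carrier G - visited G s \<sigma> \<tau>)"

end

theory Submission
  imports Defs "HOL-Algebra.Multiplicative_Group"
begin

text \<open>
  Director can stay outside a set \<open>C\<close> forever iff \<open>C\<close> is closed under midpoints: \<open>x g \<in> C\<close> and
  \<open>x g\<^sup>-\<^sup>1 \<in> C\<close> imply \<open>x \<in> C\<close>. In odd order squaring is injective, so \<open>x \<mapsto> x a\<^sup>-\<^sup>1 x\<close> permutes \<open>G\<close>, and
  counting shows that for finite \<open>C\<close> closure under midpoints is the same as closure under these
  reflections with \<open>a, x \<in> C\<close>; the nonempty sets with this property are the cosets of twisted
  subgroups. Under optimal play, once all visited positions have been visited, the set \<open>W\<close> of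
  positions Explorer can still reach against Director's strategy has a midpoint-closed complement.
  A translate of that complement misses the starting point, so \<open>f(G) \<le> |W|\<close>, and \<open>W\<close> is the whole
  visited set.
\<close>

text \<open>An injective self-map of a finite set is a permutation, so the image and the preimage of
  \<open>P\<close> both have as many elements as \<open>P\<close>, and either inclusion is already
  an equality.\<close>

lemma image_subset_iff_preimage_subset:
  assumes "finite S" "inj_on f S" "f ` S \<subseteq> S" "P \<subseteq> S"
  shows "f ` P \<subseteq> P \<longleftrightarrow> (\<forall>x\<in>S. f x \<in> P \<longrightarrow> x \<in> P)"
proof -
  have finP: "finite P" using assms finite_subset by blast
  have surj: "f ` S = S" using assms endo_inj_surj by blast
  show ?thesis
  proof
    assume "f ` P \<subseteq> P"
    moreover have "inj_on f P" using assms(2,4) by (rule inj_on_subset)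
    ultimately have "f ` P = P" using finP endo_inj_surj by blast
    show "\<forall>x\<in>S. f x \<in> P \<longrightarrow> x \<in> P"
    proof (intro ballI impI)
      fix x assume x: "x \<in> S" and "f x \<in> P"
      then have "f x \<in> f ` P" using \<open>f ` P = P\<close> by simp
      then show "x \<in> P" using inj_on_image_mem_iff[OF assms(2) x assms(4)] by simp
    qed
  next
    assume pre: "\<forall>x\<in>S. f x \<in> P \<longrightarrow> x \<in> P"
    define Q where "Q = {x \<in> S. f x \<in> P}"
    have QP: "Q \<subseteq> P" using pre by (auto simp: Q_def)
    have PQ: "P \<subseteq> f ` Q"
    proof
      fix y assume y: "y \<in> P"
      then have "y \<in> f ` S" using surj assms(4) by auto
      then show "y \<in> f ` Q" using y by (auto simp: Q_def)
    qed
    have "card P \<le> card Q" using PQ finite_subset[OF QP finP] surj_card_le by blast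
    then have "Q = P" using finP QP card_seteq by blast
    then show "f ` P \<subseteq> P" by (auto simp: Q_def)
  qed
qed

section \<open>Plays and positions\<close>

lemma length_play [simp]: "length (play \<sigma> \<tau> n) = n"
  by (induction n) (auto simp: Let_def)

text \<open>Lets Explorer deviate in a single round while all earlier rounds against the same
  Director stay as they were.\<close>

lemma play_cong:
  assumes "\<And>h. length h < n \<Longrightarrow> \<sigma> h = \<sigma>' h" "k \<le> n"
  shows "play \<sigma> \<tau> k = play \<sigma>' \<tau> k"
  using assms(2) by (induction k) (auto simp: Let_def assms(1))

lemma position_play_Suc:
  "position G s (play \<sigma> \<tau> (Suc n)) =
     (let h = play \<sigma> \<tau> n; g = \<sigma> h in
      position G s h \<otimes>\<^bsub>G\<^esub> (if \<tau> h g then g else inv\<^bsub>G\<^esub> g))"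
  by (simp add: position_def Let_def)

section \<open>Midpoints and reflections in an arbitrary group\<close>

definition midpoint_closed :: "('a, 'b) monoid_scheme \<Rightarrow> 'a set \<Rightarrow> bool" where
  "midpoint_closed G C \<longleftrightarrow> (\<forall>x\<in>carrier G. \<forall>g\<in>carrier G.
     x \<otimes>\<^bsub>G\<^esub> g \<in> C \<longrightarrow> x \<otimes>\<^bsub>G\<^esub> inv\<^bsub>G\<^esub> g \<in> C \<longrightarrow> x \<in> C)"

text \<open>The product is the mirror image of \<open>a\<close> in \<open>x\<close>: if a = x g^-1,
  then g = a^-1 x and x g = x a^-1 x.\<close>

definition reflection_closed :: "('a, 'b) monoid_scheme \<Rightarrow> 'a set \<Rightarrow> bool" where
  "reflection_closed G C \<longleftrightarrow> (\<forall>a\<in>C. \<forall>x\<in>C. x \<otimes>\<^bsub>G\<^esub> inv\<^bsub>G\<^esub> a \<otimes>\<^bsub>G\<^esub> x \<in> C)"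

context group
begin

lemma position_closed:
  assumes "s \<in> carrier G" "\<sigma> \<in> explorer_strategies G"
  shows "position G s (play \<sigma> \<tau> n) \<in> carrier G"
proof (induction n)
  case 0
  then show ?case by (simp add: position_def assms)
next
  case (Suc n)
  then show ?case using assms(2)
    unfolding position_play_Suc Let_def explorer_strategies_def by auto
qed

lemma visited_subset:
  assumes "s \<in> carrier G" "\<sigma> \<in> explorer_strategies G"
  shows "visited G s \<sigma> \<tau> \<subseteq> carrier G"
  using position_closed[OF assms] by (auto simp: visited_def)

lemma midpoint_closed_avoidable:
  assumes "midpoint_closed G C" "s \<in> carrier G" "s \<notin> C"
  shows "\<exists>\<tau>. \<forall>\<sigma>\<in>explorer_strategies G. visited G s \<sigma> \<tau> \<inter> C = {}"
proof -
  \<comment> \<open>Director multiplies by \<open>g\<close> unless this lands in \<open>C\<close>;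
    in that case midpoint closure keeps x g^-1 outside \<open>C\<close>, as the current x is
    outside.\<close>
  define \<tau> where "\<tau> h g \<longleftrightarrow> position G s h \<otimes> g \<notin> C" for h g
  have "position G s (play \<sigma> \<tau> n) \<notin> C" if "\<sigma> \<in> explorer_strategies G" for \<sigma> n
  proof (induction n)
    case 0
    then show ?case by (simp add: position_def assms)
  next
    case (Suc n)
    have "\<sigma> (play \<sigma> \<tau> n) \<in> carrier G" using that by (simp add: explorer_strategies_def)
    then have "position G s (play \<sigma> \<tau> n) \<otimes> \<sigma> (play \<sigma> \<tau> n) \<notin> C \<or>
        position G s (play \<sigma> \<tau> n) \<otimes> inv (\<sigma> (play \<sigma> \<tau> n)) \<notin> C"
      using Suc assms(1) position_closed[OF assms(2) that] unfolding midpoint_closed_def by blast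
    then show ?case unfolding position_play_Suc Let_def \<tau>_def by auto
  qed
  then have "\<forall>\<sigma>\<in>explorer_strategies G. visited G s \<sigma> \<tau> \<inter> C = {}"
    by (auto simp: visited_def)
  then show ?thesis by blast
qed

lemma reflection_closed_translate:
  assumes "reflection_closed G C" "C \<subseteq> carrier G" "g \<in> carrier G"
  shows "reflection_closed G (g <# C)"
proof -
  have "(g \<otimes> x) \<otimes> inv (g \<otimes> a) \<otimes> (g \<otimes> x) = g \<otimes> (x \<otimes> inv a \<otimes> x)"
    if "x \<in> carrier G" "a \<in> carrier G" for x a
    using that assms(3)
    by (simp add: inv_mult_group m_assoc) (simp add: m_assoc[symmetric])
  then show ?thesis
    using assms unfolding reflection_closed_def l_coset_def by (auto simp: subset_eq)
qed

text \<open>The substitution a = x g^-1 turns the two moves from x into a and its mirror image x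
  a^-1 x. For each fixed \<open>a\<close> this is the preimage form to which the counting lemma
  applies.\<close>

lemma midpoint_closed_iff:
  assumes "C \<subseteq> carrier G"
  shows "midpoint_closed G C \<longleftrightarrow>
    (\<forall>a\<in>C. \<forall>x\<in>carrier G. x \<otimes> inv a \<otimes> x \<in> C \<longrightarrow> x \<in> C)"
proof
  assume mid: "midpoint_closed G C"
  show "\<forall>a\<in>C. \<forall>x\<in>carrier G. x \<otimes> inv a \<otimes> x \<in> C \<longrightarrow> x \<in> C"
  proof (intro ballI impI)
    fix a x assume a: "a \<in> C" and x: "x \<in> carrier G" and "x \<otimes> inv a \<otimes> x \<in> C"
    then have ac: "a \<in> carrier G" and "x \<otimes> (inv a \<otimes> x) \<in> C" using assms by (auto simp: m_assoc)
    moreover have "x \<otimes> inv (inv a \<otimes> x) = a"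
      using ac x by (simp add: inv_mult_group m_assoc[symmetric])
    ultimately show "x \<in> C" using mid a x unfolding midpoint_closed_def
      by (metis inv_closed m_closed)
  qed
next
  assume ref: "\<forall>a\<in>C. \<forall>x\<in>carrier G. x \<otimes> inv a \<otimes> x \<in> C \<longrightarrow> x \<in> C"
  have "x \<otimes> inv (x \<otimes> inv g) \<otimes> x = x \<otimes> g" if "x \<in> carrier G" "g \<in> carrier G" for x g
    using that by (simp add: inv_mult_group m_assoc)
  then show "midpoint_closed G C" using ref unfolding midpoint_closed_def by metis
qed

end

section \<open>Reflections in groups of odd order\<close>

locale odd_group = group +
  assumes fin: "finite (carrier G)" and odd: "odd (order G)"
begin

text \<open>If the order is 2k + 1, raising to the power k + 1 undoes squaring.\<close>

lemma square_inj:
  assumes "x \<in> carrier G" "y \<in> carrier G" "x \<otimes> x = y \<otimes> y"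
  shows "x = y"
proof -
  obtain k where k: "order G = 2 * k + 1" using odd oddE by blast
  have "(z \<otimes> z) [^] (k + 1) = z" if z: "z \<in> carrier G" for z
  proof -
    have "(z \<otimes> z) [^] (k + 1) = (z [^] (2::nat)) [^] (k + 1)"
      using z by (simp add: numeral_2_eq_2)
    also have "\<dots> = z [^] (order G + 1)"
      unfolding nat_pow_pow[OF z] by (simp add: k)
    also have "\<dots> = z" using z pow_order_eq_1 by simp
    finally show ?thesis .
  qed
  then show ?thesis using assms by metis
qed

lemma reflection_inj:
  assumes "a \<in> carrier G"
  shows "inj_on (\<lambda>x. x \<otimes> inv a \<otimes> x) (carrier G)"
proof (rule inj_onI)
  fix x y assume x: "x \<in> carrier G" and y: "y \<in> carrier G"
    and "x \<otimes> inv a \<otimes> x = y \<otimes> inv a \<otimes> y"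
  \<comment> \<open>Multiplying by a^-1 on the right turns x a^-1 x into the square of x
    a^-1.\<close>
  then have "(x \<otimes> inv a \<otimes> x) \<otimes> inv a = (y \<otimes> inv a \<otimes> y) \<otimes> inv a" by simp
  then have "(x \<otimes> inv a) \<otimes> (x \<otimes> inv a) = (y \<otimes> inv a) \<otimes> (y \<otimes> inv a)"
    using x y assms by (simp add: m_assoc)
  then have "x \<otimes> inv a = y \<otimes> inv a"
    using x y assms square_inj[of "x \<otimes> inv a" "y \<otimes> inv a"] by blast
  then show "x = y" using x y assms by simp
qed

lemma midpoint_closed_iff_reflection_closed:
  assumes "C \<subseteq> carrier G"
  shows "midpoint_closed G C \<longleftrightarrow> reflection_closed G C"
proof -
  \<comment> \<open>For fixed \<open>a\<close> the reflection map permutes the finite group, so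
    mapping \<open>C\<close> into itself is the same as pulling \<open>C\<close> back into
    itself.\<close>
  have "(\<lambda>x. x \<otimes> inv a \<otimes> x) ` C \<subseteq> C \<longleftrightarrow>
      (\<forall>x\<in>carrier G. x \<otimes> inv a \<otimes> x \<in> C \<longrightarrow> x \<in> C)" if "a \<in> C" for a
  proof (rule image_subset_iff_preimage_subset[OF fin _ _ assms])
    show "inj_on (\<lambda>x. x \<otimes> inv a \<otimes> x) (carrier G)" using reflection_inj that assms by blast
    show "(\<lambda>x. x \<otimes> inv a \<otimes> x) ` carrier G \<subseteq> carrier G" using that assms by auto
  qed
  then show ?thesis
    unfolding midpoint_closed_iff[OF assms] reflection_closed_def by (simp add: image_subset_iff)
qed

section \<open>Twisted subgroups and midpoint-closed sets\<close>

lemma twisted_subgroup_pow: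
  assumes "twisted_subgroup G P" "a \<in> P"
  shows "a [^] (n::nat) \<in> P"
proof (induction n rule: less_induct)
  case (less n)
  have a: "a \<in> carrier G" using assms by (auto simp: twisted_subgroup_def)
  consider "n = 0" | "n = 1" | m where "n = Suc (Suc m)" by (metis One_nat_def not0_implies_Suc)
  then show ?case
  proof cases
    case 1
    then show ?thesis using assms by (simp add: twisted_subgroup_def)
  next
    case 2
    then show ?thesis using assms a by simp
  next
    case 3
    \<comment> \<open>Since a^(m+2) = a a^m a, the induction advances by two from the exponents 0
      and 1.\<close>
    then have "a \<otimes> a [^] m \<otimes> a \<in> P" using less assms by (auto simp: twisted_subgroup_def)
    moreover have "a \<otimes> a [^] m = a [^] Suc m" using a nat_pow_Suc2 by simp
    ultimately show ?thesis using 3 by simp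
  qed
qed

lemma twisted_subgroup_inv:
  assumes "twisted_subgroup G P" "a \<in> P"
  shows "inv a \<in> P"
proof -
  have a: "a \<in> carrier G" using assms by (auto simp: twisted_subgroup_def)
  \<comment> \<open>An odd order is nonzero, and a^-1 is the power of \<open>a\<close> with exponent
    one less than the order.\<close>
  obtain k where k: "order G = Suc k" using odd by (cases "order G") auto
  have "a [^] k \<otimes> a = \<one>" using pow_order_eq_1[OF a] k by simp
  then have "inv a = a [^] k" using a by (simp add: inv_equality)
  then show ?thesis using twisted_subgroup_pow[OF assms] by simp
qed

lemma twisted_coset_midpoint_closed:
  assumes "twisted_coset G P C"
  shows "midpoint_closed G C"
proof -
  obtain g where g: "g \<in> carrier G" "C = g <# P" and P: "twisted_subgroup G P"
    using assms by (auto simp: twisted_coset_def)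
  have sub: "P \<subseteq> carrier G" using P by (simp add: twisted_subgroup_def)
  have "reflection_closed G P" using P twisted_subgroup_inv[OF P]
    by (simp add: twisted_subgroup_def reflection_closed_def)
  then have "reflection_closed G C" using reflection_closed_translate sub g by simp
  moreover have "C \<subseteq> carrier G" using g sub l_coset_subset_G by simp
  ultimately show ?thesis using midpoint_closed_iff_reflection_closed by simp
qed

text \<open>Translating a point \<open>u\<close> of \<open>C\<close> to the identity preserves
  reflection closure. Reflecting in the identity then gives inverses, and reflecting b^-1 in
  \<open>a\<close> gives a b a.\<close>

lemma midpoint_closed_imp_twisted_coset:
  assumes "midpoint_closed G C" "C \<subseteq> carrier G" "C \<noteq> {}"
  shows "\<exists>P. twisted_coset G P C"
proof -
  obtain u where u: "u \<in> C" using assms by blast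
  then have uc: "u \<in> carrier G" using assms by blast
  define P where "P = inv u <# C"
  have sub: "P \<subseteq> carrier G" unfolding P_def using l_coset_subset_G assms(2) uc by simp
  have one: "\<one> \<in> P" unfolding P_def l_coset_def using u uc by force
  have ref: "reflection_closed G P"
    unfolding P_def using assms uc midpoint_closed_iff_reflection_closed
    by (simp add: reflection_closed_translate)
  have inv: "inv a \<in> P" if "a \<in> P" for a
  proof -
    have "\<one> \<otimes> inv a \<otimes> \<one> \<in> P" using ref one that unfolding reflection_closed_def by blast
    then show ?thesis using that sub by (simp add: subset_eq)
  qed
  have "a \<otimes> b \<otimes> a \<in> P" if "a \<in> P" "b \<in> P" for a b
  proof -
    have "a \<otimes> inv (inv b) \<otimes> a \<in> P"
      using ref inv[OF that(2)] that(1) unfolding reflection_closed_def by blast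
    then show ?thesis using that sub by (simp add: subset_eq)
  qed
  then have "twisted_subgroup G P" using sub one by (simp add: twisted_subgroup_def)
  moreover have "C = u <# P"
    unfolding P_def using uc assms(2) by (simp add: lcos_m_assoc lcos_mult_one)
  ultimately show ?thesis using uc unfolding twisted_coset_def by blast
qed

section \<open>The value of the game and optimal play\<close>

lemma game_value_le:
  assumes "midpoint_closed G C" "C \<subset> carrier G" "s \<in> carrier G"
  shows "game_value G s \<le> card (carrier G - C)"
proof -
  obtain w where w: "w \<in> carrier G" "w \<notin> C" using assms by blast
  \<comment> \<open>\<open>C\<close> itself may contain \<open>s\<close>. Left translation by
    \<open>g\<close> carries the point \<open>w\<close> outside \<open>C\<close> to
    \<open>s\<close>, so the translate of \<open>C\<close> misses \<open>s\<close> and Director can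
    avoid it.\<close>
  define g where "g = s \<otimes> inv w"
  have g: "g \<in> carrier G" using w assms by (simp add: g_def)
  have sub: "C \<subseteq> carrier G" using assms by blast
  have gsub: "g <# C \<subseteq> carrier G" using g sub l_coset_subset_G by simp
  have "midpoint_closed G (g <# C)"
    using assms sub gsub g
    by (simp add: midpoint_closed_iff_reflection_closed reflection_closed_translate)
  moreover have "s \<notin> g <# C"
  proof
    assume "s \<in> g <# C"
    then obtain c where c: "c \<in> C" "s = s \<otimes> inv w \<otimes> c" by (auto simp: l_coset_def g_def)
    then have cc: "c \<in> carrier G" using sub by blast
    then have "s \<otimes> \<one> = s \<otimes> (inv w \<otimes> c)" using c w assms by (simp add: m_assoc)
    then have "\<one> = inv w \<otimes> c" using w assms cc by (simp del: r_one)
    then have "w = c" using w cc by (metis inv_solve_left one_closed r_one)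
    then show False using c w by simp
  qed
  ultimately obtain \<tau> where
    \<tau>: "\<And>\<sigma>. \<sigma> \<in> explorer_strategies G \<Longrightarrow> visited G s \<sigma> \<tau> \<inter> (g <# C) = {}"
    using midpoint_closed_avoidable assms(3) by meson
  have "g <# C = (\<lambda>x. g \<otimes> x) ` C" by (auto simp: l_coset_def)
  moreover have "inj_on (\<lambda>x. g \<otimes> x) C" using g sub by (auto simp: inj_on_def subset_eq)
  ultimately have card: "card (g <# C) = card C" using card_image by simp
  have "(INF \<tau>. card (visited G s \<sigma> \<tau>)) \<le> card (carrier G - C)"
    if \<sigma>: "\<sigma> \<in> explorer_strategies G" for \<sigma>
  proof -
    have "(INF \<tau>. card (visited G s \<sigma> \<tau>)) \<le> card (visited G s \<sigma> \<tau>)"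
      by (rule cINF_lower) auto
    also have "\<dots> \<le> card (carrier G - (g <# C))"
      using visited_subset[OF assms(3) \<sigma>] \<tau>[OF \<sigma>] fin by (intro card_mono) auto
    also have "\<dots> = card (carrier G - C)"
      using card sub gsub fin by (simp add: card_Diff_subset finite_subset)
    finally show ?thesis .
  qed
  \<comment> \<open>Any strategy will do here: bounding the supremum requires a nonempty index
    set.\<close>
  moreover have "(\<lambda>_. \<one>) \<in> explorer_strategies G" by (simp add: explorer_strategies_def)
  ultimately show ?thesis unfolding game_value_def by (intro cSUP_least) auto
qed

lemma visited_complement_midpoint_closed:
  assumes s: "s \<in> carrier G"
    and "explorer_optimal G s \<sigma>" "director_optimal G s \<tau>"
  shows "midpoint_closed G (carrier G - visited G s \<sigma> \<tau>)"
    and "card (visited G s \<sigma> \<tau>) = game_value G s"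
proof -
  have \<sigma>: "\<sigma> \<in> explorer_strategies G" using assms by (simp add: explorer_optimal_def)
  define V where "V = visited G s \<sigma> \<tau>"
  have card_le: "card (visited G s \<sigma>' \<tau>) \<le> game_value G s" if "\<sigma>' \<in> explorer_strategies G" for \<sigma>'
    using assms that by (simp add: director_optimal_def)
  have cardV: "card V = game_value G s"
    using card_le[OF \<sigma>] assms by (auto simp: V_def explorer_optimal_def intro!: antisym)
  then show "card (visited G s \<sigma> \<tau>) = game_value G s" by (simp add: V_def)
  have VG: "V \<subseteq> carrier G" using visited_subset[OF s \<sigma>] by (simp add: V_def)
  then have finV: "finite V" using fin finite_subset by blast
  obtain A where A: "finite A" "V = (\<lambda>n. position G s (play \<sigma> \<tau> n)) ` A"
    using finV unfolding V_def visited_def by (meson finite_subset_image subset_refl)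
  \<comment> \<open>By round \<open>N\<close> every element of \<open>V\<close> has been
    visited.\<close>
  obtain N where N: "A \<subseteq> {..N}" using A(1) by (metis finite_nat_set_iff_bounded_le atMost_iff subsetI)
  \<comment> \<open>The positions Explorer can still reach against \<open>\<tau>\<close> after
    following the given play through round \<open>N\<close>.\<close>
  define W where "W = {position G s (play \<sigma>' \<tau> n) | \<sigma>' n.
      \<sigma>' \<in> explorer_strategies G \<and> N \<le> n \<and> (\<forall>k\<le>N. play \<sigma>' \<tau> k = play \<sigma> \<tau> k)}"
  \<comment> \<open>Such a deviation has covered \<open>V\<close> by round \<open>N\<close>, and
    optimality of \<open>\<tau>\<close> allows no more than \<open>card V\<close> elements in
    all.\<close>
  have "visited G s \<sigma>' \<tau> = V"
    if \<sigma>': "\<sigma>' \<in> explorer_strategies G" and "\<forall>k\<le>N. play \<sigma>' \<tau> k = play \<sigma> \<tau> k" for \<sigma>'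
  proof -
    have "\<forall>n\<in>A. play \<sigma> \<tau> n = play \<sigma>' \<tau> n" using that N by (metis atMost_iff subsetD)
    then have "V \<subseteq> visited G s \<sigma>' \<tau>" unfolding A(2) visited_def by auto
    moreover have "finite (visited G s \<sigma>' \<tau>)"
      using visited_subset[OF s \<sigma>'] fin finite_subset by blast
    ultimately show ?thesis using card_le[OF \<sigma>'] cardV card_seteq by metis
  qed
  then have WV: "W \<subseteq> V" unfolding W_def visited_def by blast
  have "position G s (play \<sigma> \<tau> N) \<in> W" unfolding W_def using \<sigma> by blast
  then have Wne: "W \<noteq> {}" by blast
  have step: "x \<otimes> g \<in> W \<or> x \<otimes> inv g \<in> W" if x: "x \<in> W" and g: "g \<in> carrier G" for x g
  proof -
    obtain \<sigma>' n where x: "x = position G s (play \<sigma>' \<tau> n)" and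
      \<sigma>': "\<sigma>' \<in> explorer_strategies G" "N \<le> n" "\<forall>k\<le>N. play \<sigma>' \<tau> k = play \<sigma> \<tau> k"
      using x unfolding W_def by blast
    \<comment> \<open>Explorer picks \<open>g\<close> on reaching \<open>x\<close> in round
      \<open>n\<close>. As \<open>N \<le> n\<close>, the prescribed opening is untouched, so
      whichever move \<open>\<tau>\<close> makes leads back into \<open>W\<close>.\<close>
    define \<sigma>'' where "\<sigma>'' h = (if length h = n then g else \<sigma>' h)" for h :: "'a history"
    have "\<sigma>'' \<in> explorer_strategies G"
      using \<sigma>'(1) g by (simp add: explorer_strategies_def \<sigma>''_def)
    moreover have same: "play \<sigma>'' \<tau> k = play \<sigma>' \<tau> k" if "k \<le> n" for k
      by (rule play_cong[OF _ that]) (simp add: \<sigma>''_def)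
    moreover have "\<forall>k\<le>N. play \<sigma>'' \<tau> k = play \<sigma> \<tau> k" using same \<sigma>' by simp
    ultimately have "position G s (play \<sigma>'' \<tau> (Suc n)) \<in> W"
      unfolding W_def using \<sigma>'(2) le_SucI by blast
    then show ?thesis
      unfolding position_play_Suc Let_def same[OF order_refl] x
      by (auto simp: \<sigma>''_def split: if_splits)
  qed
  then have mid: "midpoint_closed G (carrier G - W)"
    unfolding midpoint_closed_def by blast
  have "carrier G - W \<subset> carrier G" using Wne WV VG by blast
  \<comment> \<open>Avoiding a translate of the complement of \<open>W\<close> bounds the value,
    which is \<open>card V\<close>, by \<open>card W\<close>; with \<open>W \<subseteq> V\<close>
    this forces equality.\<close>
  then have "card V \<le> card (carrier G - (carrier G - W))"
    using game_value_le[OF mid _ s] cardV by simp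
  moreover have "carrier G - (carrier G - W) = W" using WV VG by blast
  ultimately have "W = V" using WV finV card_seteq by metis
  then show "midpoint_closed G (carrier G - visited G s \<sigma> \<tau>)" using mid by (simp add: V_def)
qed

lemma attainable_unvisited_twisted_coset:
  assumes s: "s \<in> carrier G" and nontriv: "carrier G \<noteq> {\<one>}" and "attainable_unvisited G s U"
  shows "\<exists>P. P \<noteq> carrier G \<and> twisted_coset G P U"
proof -
  obtain \<sigma> \<tau> where opt: "explorer_optimal G s \<sigma>" "director_optimal G s \<tau>"
    and U: "U = carrier G - visited G s \<sigma> \<tau>"
    using assms by (auto simp: attainable_unvisited_def)
  have V: "visited G s \<sigma> \<tau> \<subseteq> carrier G"
    using visited_subset[OF s] opt by (simp add: explorer_optimal_def)
  \<comment> \<open>In a nontrivial group a singleton is a proper midpoint-closed set, so Director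
    can always save at least one element and \<open>U\<close> is nonempty.\<close>
  have "{\<one>} \<subset> carrier G" using nontriv by blast
  moreover have "midpoint_closed G {\<one>}"
    by (simp add: midpoint_closed_iff_reflection_closed reflection_closed_def)
  ultimately have "game_value G s \<le> card (carrier G - {\<one>})" using game_value_le s by blast
  also have "\<dots> < card (carrier G)" using fin one_closed by (rule card_Diff1_less)
  finally have "U \<noteq> {}"
    using visited_complement_midpoint_closed(2)[OF s opt] V U by auto
  then obtain P where P: "twisted_coset G P U"
    using midpoint_closed_imp_twisted_coset visited_complement_midpoint_closed(1)[OF s opt] U
    by blast
  \<comment> \<open>Otherwise \<open>U\<close> would be the whole group, yet the starting point is
    visited.\<close>
  moreover have "P \<noteq> carrier G"
  proof
    assume "P = carrier G"
    then obtain g where "g \<in> carrier G" "U = g <# carrier G"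
      using P by (auto simp: twisted_coset_def)
    then have "U = carrier G" using lcos_mult_one lcos_m_assoc
      by (metis coset_join3 subgroup_self)
    moreover have "s = position G s (play \<sigma> \<tau> 0)" by (simp add: position_def)
    then have "s \<in> visited G s \<sigma> \<tau>" unfolding visited_def by blast
    ultimately show False using U s by blast
  qed
  ultimately show ?thesis by blast
qed

end

theorem theorem1p2:
  fixes G :: "('a, 'b) monoid_scheme" (structure) and s :: 'a
  assumes "group G" and "finite (carrier G)" and "odd (order G)"
    and "s \<in> carrier G"
  shows "(carrier G \<noteq> {\<one>} \<longrightarrow>
            (\<forall>U. attainable_unvisited G s U \<longrightarrow>
              (\<exists>P. P \<noteq> carrier G \<and> twisted_coset G P U)))
       \<and> (\<forall>P C. twisted_coset G P C \<and> s \<notin> C \<longrightarrow>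
            (\<exists>\<tau>. \<forall>\<sigma>\<in>explorer_strategies G. visited G s \<sigma> \<tau> \<inter> C = {}))"
proof -
  interpret odd_group G
    using assms by (simp add: odd_group_def odd_group_axioms_def)
  show ?thesis
    using attainable_unvisited_twisted_coset[OF assms(4)]
      midpoint_closed_avoidable[OF twisted_coset_midpoint_closed assms(4)] by blast
qed

end
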